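(* Let $\mathbb{F}\in\{\mathbb{R},\mathbb{C}\}$, and let $r\geq 1$ and $n\geq 3$ be integers. Put $$\alpha:=\Bigl(\frac{n-2}{2n-2}\Bigr)^{1/2},\qquad \beta:=\Bigl(\frac{n}{2n-2}\Bigr)^{1/2}.$$ Then any $\mathrm{EITFF}_{\mathbb{F}}(2r,r,n)$ is equivalent to an EITFF for $\mathbb{F}^{2r}$ having isometries $(\Phi_i)_{i=1}^n$ of the form $$\Phi_i=\begin{bmatrix}\alpha I\\ \beta B_i\end{bmatrix}\ \ (i=1,\dots,n-1),\qquad \Phi_n=\begin{bmatrix}I\\ 0\end{bmatrix},$$ where $I$ is the identity matrix in $\mathbb{F}^{r\times r}$ and $(B_i)_{i=1}^{n-1}$ are unitary matrices in $\mathbb{F}^{r\times r}$ that satisfy $$B_i^*B_j+B_j^*B_i=-\tfrac{2}{n-2}I\quad\text{for all distinct } i,j\in\{1,\dots,n-1\}.\qquad(\ast)$$ Conversely, for any unitary matrices $(B_i)_{i=1}^{n-1}$ in $\mathbb{F}^{r\times r}$ that satisfy $(\ast)$, the matrices $(\Phi_i)_{i=1}^n$ defined by $\Phi_i=\begin{bmatrix}\alpha I\\ \beta B_i\end{bmatrix}$ for $i=1,\dots,n-1$ and $\Phi_n=\begin{bmatrix}I\\ 0\end{bmatrix}$ are the isometries of an $\mathrm{EITFF}_{\mathbb{F}}(2r,r,n)$ for $\mathbb{F}^{2r}$.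
   Context: A "space" is a finite-dimensional Hilbert space over $\mathbb{F}\in\{\mathbb{R},\mathbb{C}\}$. For $\mathbb{F}=\mathbb{R}$, "unitary" means orthogonal, and $^*$ denotes the adjoint (conjugate transpose). Let $(\mathcal{U}_i)_{i=1}^n$, $n\geq 2$, be a sequence of $r$-dimensional subspaces of a $d$-dimensional space $\mathcal{E}$. Isometries of this sequence are linear maps $\Phi_i:\mathbb{F}^r\to\mathcal{E}$ with $\Phi_i^*\Phi_i=I$ and image $\mathcal{U}_i$; the orthogonal projection onto $\mathcal{U}_i$ is $\Pi_i=\Phi_i\Phi_i^*$. The sequence is equi-isoclinic if there is $\sigma\geq 0$ such that $\Phi_i^*\Phi_j\Phi_j^*\Phi_i=\sigma^2 I$ for all $i\neq j$ (this does not depend on the choice of isometries). It is a tight fusion frame for $\mathcal{E}$ if $\sum_{i=1}^n\Pi_i=aI$ for some $a>0$. An $\mathrm{EITFF}_{\mathbb{F}}(d,r,n)$ (equi-isoclinic tight fusion frame) is a sequence of $n$ subspaces of dimension $r$ of a $d$-dimensional space $\mathcal{E}$ over $\mathbb{F}$ that is both equi-isoclinic and a tight fusion frame for $\mathcal{E}$. Two sequences $(\mathcal{U}_i)_{i=1}^n$ and $(\widehat{\mathcal{U}}_i)_{i=1}^n$ of $r$-dimensional subspaces of $d$-dimensional spaces $\mathcal{E}$ and $\widehat{\mathcal{E}}$ over $\mathbb{F}$ are equivalent if there is a unitary $\Upsilon:\mathcal{E}\to\widehat{\mathcal{E}}$ with $\widehat{\mathcal{U}}_i=\Upsilon(\mathcal{U}_i)$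 for all $i$. *)

theory Defs
  imports "HOL-Analysis.Analysis" "Jordan_Normal_Form.Conjugate"
begin

text \<open>
  Up to isomorphism, the only members of this class are the reals (\<open>\<iota> = 0\<close>) and the complex
  numbers (\<open>\<iota>\<^sup>2 = -1\<close>), with their usual conjugation.
\<close>

class real_or_complex = real_field + conjugatable_field +
  assumes real_or_complex:
    "\<exists>\<iota>. (\<iota> = 0 \<or> \<iota> * \<iota> = - 1) \<and>
       (\<forall>x. \<exists>a b. x = a *\<^sub>R 1 + b *\<^sub>R \<iota> \<and> conjugate x = a *\<^sub>R 1 - b *\<^sub>R \<iota>)"

instance real :: real_or_complex
  by standard (auto intro: exI[of _ 0])

instance complex :: real_or_complex
proof
  show "\<exists>\<iota>::complex. (\<iota> = 0 \<or> \<iota> * \<iota> = - 1) \<and>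
       (\<forall>x. \<exists>a b. x = a *\<^sub>R 1 + b *\<^sub>R \<iota> \<and> conjugate x = a *\<^sub>R 1 - b *\<^sub>R \<iota>)"
  proof (intro exI[of _ \<i>] conjI allI)
    fix x :: complex
    show "\<exists>a b. x = a *\<^sub>R 1 + b *\<^sub>R \<i> \<and> conjugate x = a *\<^sub>R 1 - b *\<^sub>R \<i>"
      by (rule exI[of _ "Re x"], rule exI[of _ "Im x"]) (simp add: complex_eq_iff)
  qed simp
qed

text \<open>
  Inner products are conjugate-linear in the first argument. Completeness is automatic
  in finite dimension.
\<close>

locale fd_hilbert_space = vector_space smul
  for smul :: "'f::real_or_complex \<Rightarrow> 'e::ab_group_add \<Rightarrow> 'e" +
  fixes ip :: "'e \<Rightarrow> 'e \<Rightarrow> 'f"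
  assumes finite_spanning: "\<exists>S. finite S \<and> span S = UNIV"
    and ip_add: "ip x (y + z) = ip x y + ip x z"
    and ip_smul: "ip x (smul c y) = c * ip x y"
    and ip_conjugate: "ip y x = conjugate (ip x y)"
    and ip_pos: "x \<noteq> 0 \<Longrightarrow> \<exists>a>0. ip x x = of_real a"

definition std_ip :: "'f::real_or_complex ^ 'm \<Rightarrow> 'f ^ 'm \<Rightarrow> 'f" where
  "std_ip x y = (\<Sum>k\<in>UNIV. conjugate (x $ k) * y $ k)"

definition ip_adjoint ::
  "('a \<Rightarrow> 'a \<Rightarrow> 'f) \<Rightarrow> ('b \<Rightarrow> 'b \<Rightarrow> 'f) \<Rightarrow> ('a \<Rightarrow> 'b) \<Rightarrow> 'b \<Rightarrow> 'a" where
  "ip_adjoint ipa ipb T = (SOME S. \<forall>x y. ipb (T x) y = ipa x (S y))"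

definition unitary_map ::
  "('f::real_or_complex \<Rightarrow> 'a::ab_group_add \<Rightarrow> 'a) \<Rightarrow> ('a \<Rightarrow> 'a \<Rightarrow> 'f) \<Rightarrow>
   ('f \<Rightarrow> 'b::ab_group_add \<Rightarrow> 'b) \<Rightarrow> ('b \<Rightarrow> 'b \<Rightarrow> 'f) \<Rightarrow> ('a \<Rightarrow> 'b) \<Rightarrow> bool" where
  "unitary_map smula ipa smulb ipb T \<longleftrightarrow>
     Vector_Spaces.linear smula smulb T \<and> bij T \<and> (\<forall>x y. ipb (T x) (T y) = ipa x y)"

definition orth_proj ::
  "('e \<Rightarrow> 'e \<Rightarrow> 'f::real_or_complex) \<Rightarrow> 'e::ab_group_add set \<Rightarrow> 'e \<Rightarrow> 'e" where
  "orth_proj ip U v = (THE u. u \<in> U \<and> (\<forall>w\<in>U. ip w (v - u) = 0))"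

definition isometry_of ::
  "('f::real_or_complex \<Rightarrow> 'e::ab_group_add \<Rightarrow> 'e) \<Rightarrow> ('e \<Rightarrow> 'e \<Rightarrow> 'f) \<Rightarrow>
   'e set \<Rightarrow> ('f ^ 'r \<Rightarrow> 'e) \<Rightarrow> bool" where
  "isometry_of smul ip U \<Phi> \<longleftrightarrow>
     Vector_Spaces.linear (*s) smul \<Phi> \<and>
     ip_adjoint std_ip ip \<Phi> \<circ> \<Phi> = id \<and> range \<Phi> = U"

text \<open>
  Sequences of subspaces are indexed by \<open>{1..n}\<close>; other indices are irrelevant.
  The type \<open>'r\<close> supplies the domain \<open>'f ^ 'r\<close> of the isometries, so the
  subspaces have dimension \<open>CARD('r)\<close>. The condition on the \<open>\<Phi> i\<close> does not depend on
  the choice of isometries.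
\<close>

definition equi_isoclinic ::
  "('f::real_or_complex \<Rightarrow> 'e::ab_group_add \<Rightarrow> 'e) \<Rightarrow> ('e \<Rightarrow> 'e \<Rightarrow> 'f) \<Rightarrow>
   'r::finite itself \<Rightarrow> nat \<Rightarrow> (nat \<Rightarrow> 'e set) \<Rightarrow> bool" where
  "equi_isoclinic smul ip (_ :: 'r itself) n U \<longleftrightarrow>
     (\<exists>\<Phi> :: nat \<Rightarrow> 'f ^ 'r \<Rightarrow> 'e.
        (\<forall>i\<in>{1..n}. isometry_of smul ip (U i) (\<Phi> i)) \<and>
        (\<exists>\<sigma>\<ge>0. \<forall>i\<in>{1..n}. \<forall>j\<in>{1..n}. i \<noteq> j \<longrightarrow>
           (\<forall>x. (ip_adjoint std_ip ip (\<Phi> i) \<circ> \<Phi> j \<circ> ip_adjoint std_ip ip (\<Phi> j) \<circ> \<Phi> i) x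
                = of_real (\<sigma>\<^sup>2) *s x)))"

definition tight_fusion_frame ::
  "('f::real_or_complex \<Rightarrow> 'e::ab_group_add \<Rightarrow> 'e) \<Rightarrow> ('e \<Rightarrow> 'e \<Rightarrow> 'f) \<Rightarrow>
   nat \<Rightarrow> (nat \<Rightarrow> 'e set) \<Rightarrow> bool" where
  "tight_fusion_frame smul ip n U \<longleftrightarrow>
     (\<exists>a>0. \<forall>v. (\<Sum>i=1..n. orth_proj ip (U i) v) = smul (of_real a) v)"

definition EITFF ::
  "('f::real_or_complex \<Rightarrow> 'e::ab_group_add \<Rightarrow> 'e) \<Rightarrow> ('e \<Rightarrow> 'e \<Rightarrow> 'f) \<Rightarrow>
   nat \<Rightarrow> 'r::finite itself \<Rightarrow> nat \<Rightarrow> (nat \<Rightarrow> 'e set) \<Rightarrow> bool" where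
  "EITFF smul ip d (R :: 'r itself) n U \<longleftrightarrow>
     fd_hilbert_space smul ip \<and> vector_space.dim smul (UNIV :: 'e set) = d \<and>
     (\<forall>i\<in>{1..n}. module.subspace smul (U i) \<and> vector_space.dim smul (U i) = CARD('r)) \<and>
     equi_isoclinic smul ip R n U \<and> tight_fusion_frame smul ip n U"

definition equivalent_seq ::
  "('f::real_or_complex \<Rightarrow> 'a::ab_group_add \<Rightarrow> 'a) \<Rightarrow> ('a \<Rightarrow> 'a \<Rightarrow> 'f) \<Rightarrow>
   ('f \<Rightarrow> 'b::ab_group_add \<Rightarrow> 'b) \<Rightarrow> ('b \<Rightarrow> 'b \<Rightarrow> 'f) \<Rightarrow>
   nat \<Rightarrow> (nat \<Rightarrow> 'a set) \<Rightarrow> (nat \<Rightarrow> 'b set) \<Rightarrow> bool" where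
  "equivalent_seq smula ipa smulb ipb n U V \<longleftrightarrow>
     (\<exists>T. unitary_map smula ipa smulb ipb T \<and> (\<forall>i\<in>{1..n}. V i = T ` U i))"

definition conj_transpose :: "'f::real_or_complex ^ 'n ^ 'm \<Rightarrow> 'f ^ 'm ^ 'n" where
  "conj_transpose A = (\<chi> i j. conjugate (A $ j $ i))"

definition unitary_matrix :: "'f::real_or_complex ^ 'n ^ 'n \<Rightarrow> bool" where
  "unitary_matrix B \<longleftrightarrow> conj_transpose B ** B = mat 1 \<and> B ** conj_transpose B = mat 1"

text \<open>
  The block column with \<open>A\<close> above \<open>C\<close>. Here \<open>'f ^ ('m + 'k)\<close> is coordinate space of
  dimension \<open>CARD('m) + CARD('k)\<close>, with the coordinates of index \<open>Inl i\<close> listed first.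
\<close>

definition block_column ::
  "'f ^ 'n ^ 'm::finite \<Rightarrow> 'f ^ 'n ^ 'k::finite \<Rightarrow> 'f ^ 'n ^ ('m + 'k)" where
  "block_column A C = (\<chi> i. case i of Inl p \<Rightarrow> A $ p | Inr q \<Rightarrow> C $ q)"

lemma of_real_conjugate [simp]: "conjugate (of_real a) = (of_real a :: 'f::real_or_complex)"
proof -
  obtain \<iota> :: 'f where i: "\<iota> = 0 \<or> \<iota> * \<iota> = - 1"
    and H: "\<And>x. \<exists>a b. x = of_real a + of_real b * \<iota> \<and> conjugate x = of_real a - of_real b * \<iota>"
    using real_or_complex[where ?'a = 'f]
    unfolding scaleR_conv_of_real mult_1_right by blast
  from H obtain p q where p: "of_real a = of_real p + of_real q * \<iota>"
    and c: "conjugate (of_real a :: 'f) = of_real p - of_real q * \<iota>" by blast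
  have "of_real q * \<iota> = 0"
  proof (cases "\<iota> = 0")
    case False
    with i have i2: "\<iota> * \<iota> = - 1" by blast
    have "of_real (a - p) = of_real q * \<iota>" using p by simp
    hence "of_real (a - p) * of_real (a - p) = (of_real q * \<iota>) * (of_real q * \<iota>)" by simp
    also have "\<dots> = of_real q * of_real q * (\<iota> * \<iota>)" by (simp only: ac_simps)
    also have "\<dots> = of_real (- (q * q))" using i2 by simp
    finally have "(a - p) * (a - p) = - (q * q)"
      by (metis of_real_eq_iff of_real_mult)
    hence "q * q \<le> 0" by (metis neg_0_le_iff_le zero_le_square)
    thus ?thesis by (auto simp: mult_le_0_iff)
  qed simp
  with p c show ?thesis by simp
qed

lemma conjugate_mult_self: "\<exists>a\<ge>0. conjugate x * x = (of_real a :: 'f::real_or_complex)"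
proof -
  obtain \<iota> :: 'f where i: "\<iota> = 0 \<or> \<iota> * \<iota> = - 1"
    and H: "\<And>x. \<exists>a b. x = of_real a + of_real b * \<iota> \<and> conjugate x = of_real a - of_real b * \<iota>"
    using real_or_complex[where ?'a = 'f]
    unfolding scaleR_conv_of_real mult_1_right by blast
  from H obtain p q where x: "x = of_real p + of_real q * \<iota>"
    "conjugate x = of_real p - of_real q * \<iota>" by blast
  have "conjugate x * x = of_real (p * p) - of_real (q * q) * (\<iota> * \<iota>)"
    unfolding x(2) by (subst x(1)) (simp add: algebra_simps)
  also have "\<dots> = of_real (if \<iota> = 0 then p * p else p * p + q * q)"
    using i by auto
  finally show ?thesis by (intro exI conjI) auto
qed

lemma fd_hilbert_space_std:
  "fd_hilbert_space (*s) (std_ip :: 'f::real_or_complex ^ 'm \<Rightarrow> 'f ^ 'm \<Rightarrow> 'f)"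
proof (unfold_locales, goal_cases)
  case 1
  show ?case using vec.span_Basis vec.finite_Basis by (intro exI conjI)
next
  case (2 x y z)
  then show ?case by (simp add: std_ip_def algebra_simps sum.distrib)
next
  case (3 x c y)
  then show ?case by (simp add: std_ip_def algebra_simps sum_distrib_left)
next
  case (4 y x)
  then show ?case by (simp add: std_ip_def sum_conjugate conjugate_dist_mul mult.commute)
next
  case (5 x)
  obtain f where f: "\<And>k. f k \<ge> 0" "\<And>k. conjugate (x $ k) * x $ k = of_real (f k)"
    using choice[of "\<lambda>k a. a \<ge> 0 \<and> conjugate (x $ k) * x $ k = of_real a"]
      conjugate_mult_self by blast
  obtain k where "x $ k \<noteq> 0" using 5 by (auto simp: vec_eq_iff)
  hence "f k \<noteq> 0" using f(2)[of k] by auto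
  with f(1) have "(\<Sum>k\<in>UNIV. f k) > 0"
    by (intro sum_pos2[of _ k]) (auto simp: order_less_le)
  moreover have "std_ip x x = of_real (\<Sum>k\<in>UNIV. f k)"
    by (simp add: std_ip_def f(2))
  ultimately show ?case by blast
qed

lemma (in fd_hilbert_space) ip_left_cancel:
  assumes "\<And>x. ip x y = ip x z"
  shows "y = z"
proof (rule ccontr)
  assume "y \<noteq> z"
  then obtain a where a: "a > 0" "ip (y - z) (y - z) = of_real a" using ip_pos[of "y - z"] by auto
  have "ip (y - z) y = ip (y - z) (y - z) + ip (y - z) z" by (simp flip: ip_add)
  with assms a show False by simp
qed

lemma ip_adjoint_eqI:
  assumes "fd_hilbert_space smula ipa" "\<And>x y. ipb (T x) y = ipa x (S y)"
  shows "ip_adjoint ipa ipb T = S"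
proof -
  have "\<forall>x y. ipb (T x) y = ipa x (ip_adjoint ipa ipb T y)"
    unfolding ip_adjoint_def by (rule someI[of _ S]) (use assms in blast)
  with assms show ?thesis
    by (intro ext fd_hilbert_space.ip_left_cancel[OF assms(1)]) metis
qed

lemma ip_adjoint_matrix:
  fixes A :: "'f::real_or_complex ^ 'n ^ 'm"
  shows "ip_adjoint std_ip std_ip ((*v) A) = (*v) (conj_transpose A)"
proof (rule ip_adjoint_eqI[OF fd_hilbert_space_std])
  fix x :: "'f ^ 'n" and y :: "'f ^ 'm"
  have "std_ip (A *v x) y =
    (\<Sum>k\<in>UNIV. \<Sum>j\<in>UNIV. conjugate (A $ k $ j) * conjugate (x $ j) * y $ k)"
    by (simp add: std_ip_def matrix_vector_mult_def sum_conjugate conjugate_dist_mul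
        sum_distrib_right)
  also have "\<dots> = (\<Sum>j\<in>UNIV. \<Sum>k\<in>UNIV. conjugate (A $ k $ j) * conjugate (x $ j) * y $ k)"
    by (rule sum.swap)
  also have "\<dots> = std_ip x (conj_transpose A *v y)"
    by (simp add: std_ip_def matrix_vector_mult_def conj_transpose_def sum_distrib_left
        mult.assoc mult.left_commute)
  finally show "std_ip (A *v x) y = std_ip x (conj_transpose A *v y)" .
qed

lemma (in fd_hilbert_space) ip_adjoint_coordinates:
  fixes \<Phi> :: "'f ^ 'r \<Rightarrow> 'e"
  assumes lin: "Vector_Spaces.linear (*s) smul \<Phi>"
  shows "ip (\<Phi> x) y = std_ip x (ip_adjoint std_ip ip \<Phi> y)"
proof -
  interpret \<Phi>: Vector_Spaces.linear "(*s)" smul \<Phi> by (rule lin)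
  define \<Psi> where "\<Psi> y = (\<chi> k. ip (\<Phi> (axis k 1)) y)" for y
  have zero: "ip z 0 = 0" for z using ip_smul[of z 0 0] by simp
  have sum: "ip z (sum g K) = (\<Sum>k\<in>K. ip z (g k))" if "finite K" for z g and K :: "'r set"
    using that by induction (auto simp: zero ip_add)
  have eq: "ip (\<Phi> x) y = std_ip x (\<Psi> y)" for x y
  proof -
    have "ip (\<Phi> x) y = conjugate (ip y (\<Phi> (\<Sum>k\<in>UNIV. x $ k *s axis k 1)))"
      by (simp only: ip_conjugate[of "\<Phi> x" y] basis_expansion)
    also have "\<dots> = conjugate (\<Sum>k\<in>UNIV. x $ k * ip y (\<Phi> (axis k 1)))"
      by (simp add: \<Phi>.sum \<Phi>.scale sum ip_smul)
    also have "\<dots> = std_ip x (\<Psi> y)"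
      by (simp add: sum_conjugate conjugate_dist_mul std_ip_def \<Psi>_def flip: ip_conjugate)
    finally show ?thesis .
  qed
  have "ip_adjoint std_ip ip \<Phi> = \<Psi>"
    by (rule ip_adjoint_eqI, rule fd_hilbert_space_std, rule eq)
  with eq show ?thesis by simp
qed

lemma (in fd_hilbert_space) orth_proj_isometry:
  fixes \<Phi> :: "'f ^ 'r \<Rightarrow> 'e"
  assumes iso: "isometry_of smul ip U \<Phi>"
  shows "orth_proj ip U = \<Phi> \<circ> ip_adjoint std_ip ip \<Phi>"
proof
  fix v
  define \<Psi> where "\<Psi> = ip_adjoint std_ip ip \<Phi>"
  have adj: "ip (\<Phi> x) y = std_ip x (\<Psi> y)" for x y
    using iso unfolding \<Psi>_def isometry_of_def by (intro ip_adjoint_coordinates) blast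
  note eq = \<Psi>_def[symmetric]
  have inv: "\<Psi> (\<Phi> x) = x" for x
    using iso unfolding isometry_of_def eq by (metis comp_apply id_apply)
  have U: "U = range \<Phi>" using iso by (simp add: isometry_of_def)
  have *: "(\<forall>w\<in>U. ip w (v - u) = 0) \<longleftrightarrow> (\<forall>w\<in>U. ip w u = ip w v)" for u
  proof -
    have "ip w v = ip w (v - u) + ip w u" for w by (simp flip: ip_add)
    thus ?thesis by auto
  qed
  show "orth_proj ip U v = (\<Phi> \<circ> ip_adjoint std_ip ip \<Phi>) v"
    unfolding orth_proj_def * eq
  proof (rule the_equality)
    show "(\<Phi> \<circ> \<Psi>) v \<in> U \<and> (\<forall>w\<in>U. ip w ((\<Phi> \<circ> \<Psi>) v) = ip w v)"
      by (auto simp: U adj inv)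
  next
    fix u assume u: "u \<in> U \<and> (\<forall>w\<in>U. ip w u = ip w v)"
    then obtain x where x: "u = \<Phi> x" by (auto simp: U)
    have "std_ip z x = std_ip z (\<Psi> v)" for z
      using u by (auto simp: U x adj inv)
    hence "x = \<Psi> v" by (rule fd_hilbert_space.ip_left_cancel[OF fd_hilbert_space_std])
    thus "u = (\<Phi> \<circ> \<Psi>) v" by (simp add: x)
  qed
qed

end

theory Submission
  imports Defs
begin

text \<open>
  Projecting the first subspace onto the orthogonal complement of the last one and rescaling gives
  an isometry onto that complement, since the complement is also \<open>r\<close>-dimensional. It yields
  coordinates in which the last isometry is \<open>I\<close> above \<open>0\<close> and the others are \<open>A\<^sub>i\<close> above \<open>C\<^sub>i\<close>.
  Isoclinism makes \<open>A\<^sub>i\<close> and \<open>C\<^sub>i\<close> scaled unitaries with squared scales \<open>s\<close> and \<open>1 - s\<close>, and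
  comparing the diagonal blocks of \<open>\<Sum> \<Pi>\<^sub>i = a I\<close> gives \<open>(n - 1) s + 1 = a = (n - 1) (1 - s)\<close>,
  hence \<open>s = \<alpha>\<^sup>2\<close>. Multiplying the isometries on the right by \<open>A\<^sub>i\<^sup>* / \<alpha>\<close> produces the normal form,
  for which isoclinism is equivalent to \<open>(\<ast>)\<close>. Conversely, \<open>(\<ast>)\<close> implies
  \<open>(\<Sum> B\<^sub>i)\<^sup>* (\<Sum> B\<^sub>i) = 0\<close>, so \<open>\<Sum> B\<^sub>i = 0\<close>, which is tightness of the off-diagonal blocks.
\<close>

section \<open>Matrix algebra: real scalars, conjugate transposes, scaled unitaries\<close>

lemma scaleR_matrix_mult_left:
  fixes A :: "'a::real_algebra_1 ^ 'n ^ 'm"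
  shows "(c *\<^sub>R A) ** B = c *\<^sub>R (A ** B)"
  by (simp add: vec_eq_iff matrix_matrix_mult_def scaleR_sum_right)

lemma scaleR_matrix_mult_right:
  fixes A :: "'a::real_algebra_1 ^ 'n ^ 'm"
  shows "A ** (c *\<^sub>R B) = c *\<^sub>R (A ** B)"
  by (simp add: vec_eq_iff matrix_matrix_mult_def scaleR_sum_right)

lemma matrix_mult_add_left:
  fixes A B :: "'a::semiring_1 ^ 'n ^ 'm"
  shows "(A + B) ** C = A ** C + B ** C"
  by (simp add: vec_eq_iff matrix_matrix_mult_def distrib_right sum.distrib)

lemma matrix_mult_sum_left:
  fixes B :: "'a::semiring_1 ^ 'n ^ 'm"
  shows "(\<Sum>i\<in>I. A i) ** B = (\<Sum>i\<in>I. A i ** B)"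
  by (simp add: vec_eq_iff matrix_matrix_mult_def sum_distrib_right) (intro allI sum.swap)

lemma matrix_mult_sum_right:
  fixes A :: "'a::semiring_1 ^ 'n ^ 'm"
  shows "A ** (\<Sum>i\<in>I. B i) = (\<Sum>i\<in>I. A ** B i)"
  by (simp add: vec_eq_iff matrix_matrix_mult_def sum_distrib_left) (intro allI sum.swap)

lemma sum_matrix_vector_mult:
  fixes A :: "'i \<Rightarrow> 'a::semiring_1 ^ 'n ^ 'm"
  shows "(\<Sum>i\<in>I. A i) *v x = (\<Sum>i\<in>I. A i *v x)"
  by (induction I rule: infinite_finite_induct) (auto simp: matrix_vector_mult_add_rdistrib)

lemma scaleR_matrix_vector_mult:
  fixes A :: "'a::real_algebra_1 ^ 'n ^ 'm"
  shows "(c *\<^sub>R A) *v x = of_real c *s (A *v x)"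
proof -
  have "(c *\<^sub>R a) * b = of_real c * (a * b)" for a b :: 'a
    by (simp add: scaleR_conv_of_real mult.assoc)
  then show ?thesis by (simp add: vec_eq_iff matrix_vector_mult_def sum_distrib_left)
qed

text \<open>Index types are nonempty, so \<open>mat 1\<close> is nonzero. This is how an equation
  between multiples of the identity becomes one between real numbers.\<close>

lemma scaleR_mat_cancel:
  "x *\<^sub>R (mat 1 :: 'a::real_algebra_1 ^ 'n ^ 'n) = y *\<^sub>R mat 1 \<longleftrightarrow> x = y"
proof -
  have "(mat 1 :: 'a ^ 'n ^ 'n) \<noteq> 0"
    by (auto simp: vec_eq_iff mat_def)
  then show ?thesis by simp
qed

lemma conj_transpose_mult:
  fixes A :: "'f::real_or_complex ^ 'n ^ 'm"
  shows "conj_transpose (A ** B) = conj_transpose B ** conj_transpose A"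
  by (simp add: vec_eq_iff conj_transpose_def matrix_matrix_mult_def sum_conjugate
      conjugate_dist_mul mult.commute)

lemma conj_transpose_add: "conj_transpose (A + B) = conj_transpose A + conj_transpose B"
  by (simp add: vec_eq_iff conj_transpose_def conjugate_dist_add)

lemma conj_transpose_scaleR:
  fixes A :: "'a::real_or_complex ^ 'n ^ 'm"
  shows "conj_transpose (c *\<^sub>R A) = c *\<^sub>R conj_transpose A"
proof -
  have "conjugate (c *\<^sub>R x) = c *\<^sub>R conjugate x" for x :: 'a
    by (simp add: scaleR_conv_of_real conjugate_dist_mul)
  then show ?thesis by (simp add: vec_eq_iff conj_transpose_def)
qed

lemma conj_transpose_conj_transpose: "conj_transpose (conj_transpose A) = A"
  by (simp add: vec_eq_iff conj_transpose_def)

lemma conj_transpose_zero: "conj_transpose 0 = 0"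
  by (simp add: vec_eq_iff conj_transpose_def)

lemma conj_transpose_mat_1: "conj_transpose (mat 1) = mat 1"
  using of_real_conjugate[of 1] by (simp add: vec_eq_iff conj_transpose_def mat_def)

lemma conj_transpose_sum: "conj_transpose (\<Sum>i\<in>I. A i) = (\<Sum>i\<in>I. conj_transpose (A i))"
  by (induction I rule: infinite_finite_induct) (auto simp: conj_transpose_zero conj_transpose_add)

lemmas matrix_simps = scaleR_matrix_mult_left scaleR_matrix_mult_right conj_transpose_mult
  conj_transpose_add conj_transpose_scaleR conj_transpose_conj_transpose conj_transpose_zero
  conj_transpose_mat_1 matrix_add_ldistrib matrix_mult_add_left

lemma std_ip_matrix: "std_ip (A *v x) y = std_ip x (conj_transpose A *v y)"
  using fd_hilbert_space.ip_adjoint_coordinates[OF fd_hilbert_space_std matrix_vector_mul_linear_gen]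
  by (metis ip_adjoint_matrix)

text \<open>The squared norm of \<open>A *v x\<close> is the inner product of \<open>x\<close> with
  \<open>conj_transpose A ** A *v x\<close>, and the standard inner product is definite.\<close>

lemma conj_transpose_mult_self_eq_0:
  fixes A :: "'f::real_or_complex ^ 'n ^ 'm"
  assumes "conj_transpose A ** A = 0"
  shows "A = 0"
proof -
  have "A *v x = 0" for x
  proof (rule ccontr)
    assume "A *v x \<noteq> 0"
    then obtain a where "a > 0" "std_ip (A *v x) (A *v x) = of_real a"
      using fd_hilbert_space.ip_pos[OF fd_hilbert_space_std] by metis
    moreover have "std_ip (A *v x) (A *v x) = 0"
      by (simp add: std_ip_matrix matrix_vector_mul_assoc assms) (simp add: std_ip_def)
    ultimately show False by simp
  qed
  then show ?thesis by (simp add: matrix_eq)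
qed

text \<open>After division by \<open>c\<close> the hypothesis exhibits a left inverse of a square
  matrix, which is also a right inverse.\<close>

lemma scaled_unitary_right:
  fixes A :: "'f::real_or_complex ^ 'n ^ 'n"
  assumes "conj_transpose A ** A = c *\<^sub>R mat 1" "c \<noteq> 0"
  shows "A ** conj_transpose A = c *\<^sub>R mat 1"
proof -
  have "((1 / c) *\<^sub>R conj_transpose A) ** A = mat 1"
    using assms by (simp add: matrix_simps)
  then have "A ** ((1 / c) *\<^sub>R conj_transpose A) = mat 1"
    by (simp only: matrix_left_right_inverse)
  then have "c *\<^sub>R (A ** ((1 / c) *\<^sub>R conj_transpose A)) = c *\<^sub>R mat 1"
    by simp
  with \<open>c \<noteq> 0\<close> show ?thesis by (simp add: matrix_simps)
qed

section \<open>Block columns and their Gram products\<close>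

lemma block_column_eqI:
  assumes "\<And>i. M $ Inl i = A $ i" "\<And>i. M $ Inr i = C $ i"
  shows "M = block_column A C"
  using assms by (auto simp: vec_eq_iff block_column_def split: sum.split)

lemma block_column_add:
  "block_column A C + block_column A' C' = block_column (A + A') (C + C')"
  by (rule block_column_eqI) (auto simp: block_column_def)

lemma block_column_0: "block_column 0 0 = 0"
  by (rule block_column_eqI[symmetric]) auto

lemma block_column_sum:
  "(\<Sum>i\<in>I. block_column (A i) (C i)) = block_column (\<Sum>i\<in>I. A i) (\<Sum>i\<in>I. C i)"
  by (induction I rule: infinite_finite_induct) (auto simp: block_column_0 block_column_add)

lemma block_column_scaleR: "c *\<^sub>R block_column A C = block_column (c *\<^sub>R A) (c *\<^sub>R C)"
  by (rule block_column_eqI) (auto simp: block_column_def)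

lemma block_column_mult: "block_column A C ** X = block_column (A ** X) (C ** X)"
  by (rule block_column_eqI) (auto simp: block_column_def matrix_matrix_mult_def vec_eq_iff)

lemma sum_UNIV_Plus:
  "(\<Sum>k\<in>UNIV. f k) = (\<Sum>i\<in>UNIV. f (Inl i)) + (\<Sum>i\<in>UNIV. f (Inr i))"
  for f :: "'a::finite + 'b::finite \<Rightarrow> 'c::comm_monoid_add"
  by (simp add: UNIV_Plus_UNIV[symmetric] sum.Plus comp_def del: UNIV_Plus_UNIV)

lemma conj_transpose_block_column_mult:
  "conj_transpose (block_column A C) ** block_column A' C' =
    conj_transpose A ** A' + conj_transpose C ** C'"
  by (simp add: vec_eq_iff conj_transpose_def matrix_matrix_mult_def sum_UNIV_Plus block_column_def)

text \<open>The two block columns side by side form the identity, so the products are the left and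
  right halves of the matrix. Identities between square matrices of size \<open>r + r\<close> can
  thus be tested on block columns alone.\<close>

lemma block_column_mult_cancel:
  fixes X Y :: "'f::semiring_1 ^ ('m::finite + 'k::finite) ^ 'n"
  assumes "X ** block_column (mat 1) 0 = Y ** block_column (mat 1) 0"
    and "X ** block_column 0 (mat 1) = Y ** block_column 0 (mat 1)"
  shows "X = Y"
proof -
  have *: "(Z ** block_column (mat 1) 0) $ i $ j = Z $ i $ Inl j"
    "(Z ** block_column 0 (mat 1)) $ i $ k = Z $ i $ Inr k"
    for Z :: "'f ^ ('m + 'k) ^ 'n" and i j k
    by (simp_all add: matrix_matrix_mult_def sum_UNIV_Plus block_column_def mat_def if_distrib cong: if_cong)
  have "X $ i $ l = Y $ i $ l" for i l
    using assms by (cases l) (metis *)+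
  then show ?thesis by (simp add: vec_eq_iff)
qed

text \<open>With \<open>U = conj_transpose B ** B'\<close>, the first factor is
  \<open>a\<^sup>2 I + b\<^sup>2 U\<close> and the second is its adjoint. Since \<open>U\<close> is
  unitary, their product has the constant part \<open>a^4 + b^4\<close> and a cross term in
  \<open>U\<close> plus its adjoint.\<close>

lemma gram_block_column:
  fixes B B' :: "'f::real_or_complex ^ 'r ^ 'r" and a b :: real
  assumes "unitary_matrix B" "unitary_matrix B'"
  defines "N \<equiv> block_column (a *\<^sub>R mat 1) (b *\<^sub>R B)"
    and "N' \<equiv> block_column (a *\<^sub>R mat 1) (b *\<^sub>R B')"
  shows "conj_transpose N ** N' ** (conj_transpose N' ** N) =
    (a ^ 4 + b ^ 4) *\<^sub>R mat 1 +
    (a\<^sup>2 * b\<^sup>2) *\<^sub>R (conj_transpose B ** B' + conj_transpose B' ** B)"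
proof -
  have "conj_transpose B ** B' ** (conj_transpose B' ** B) =
      conj_transpose B ** (B' ** conj_transpose B') ** B"
    by (simp add: matrix_mul_assoc)
  also have "\<dots> = mat 1" using assms(1,2) by (simp add: unitary_matrix_def)
  finally have *: "conj_transpose B ** B' ** (conj_transpose B' ** B) = mat 1" .
  show ?thesis
    unfolding N_def N'_def conj_transpose_block_column_mult
    by (simp add: matrix_simps * scaleR_add_right)
      (simp add: algebra_simps power2_eq_square power4_eq_xxxx scaleR_add_left)
qed

section \<open>From matrix identities to equi-isoclinic tight fusion frames\<close>

lemma isometry_of_matrix:
  fixes M :: "'f::real_or_complex ^ 'r ^ 'd"
  assumes "conj_transpose M ** M = mat 1"
  shows "isometry_of (*s) std_ip (range ((*v) M)) ((*v) M)"
  using assms by (auto simp: isometry_of_def ip_adjoint_matrix matrix_vector_mul_assoc fun_eq_iff)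

text \<open>Adjoints of matrix maps are conjugate transposes, a left inverse makes each
  \<open>M i\<close> injective and so fixes the dimension of its range, and
  \<open>M i ** conj_transpose (M i)\<close> is the orthogonal projection onto that range.\<close>

lemma EITFF_matrix:
  fixes M :: "nat \<Rightarrow> 'f::real_or_complex ^ 'r ^ 'd"
  assumes gram: "\<And>i. i \<in> {1..n} \<Longrightarrow> conj_transpose (M i) ** M i = mat 1"
    and isoclinic: "\<And>i j. i \<in> {1..n} \<Longrightarrow> j \<in> {1..n} \<Longrightarrow> i \<noteq> j \<Longrightarrow>
      conj_transpose (M i) ** M j ** (conj_transpose (M j) ** M i) = \<sigma>\<^sup>2 *\<^sub>R mat 1"
    and "\<sigma> \<ge> 0"
    and tight: "(\<Sum>i=1..n. M i ** conj_transpose (M i)) = a *\<^sub>R mat 1"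
    and "a > 0"
  shows "EITFF (*s) std_ip CARD('d) TYPE('r) n (\<lambda>i. range ((*v) (M i)))"
  unfolding EITFF_def
proof (intro conjI ballI)
  show "fd_hilbert_space (*s) (std_ip :: 'f ^ 'd \<Rightarrow> _)" by (rule fd_hilbert_space_std)
  show "vec.dim (UNIV :: ('f ^ 'd) set) = CARD('d)" by (rule vec_dim_card)
  fix i assume i: "i \<in> {1..n}"
  show "vec.subspace (range ((*v) (M i)))"
    using vec.subspace_image[OF vec.subspace_UNIV] by blast
  have "inj ((*v) (M i))"
    using gram[OF i] matrix_left_invertible_injective by blast
  then have "vec.dim (range ((*v) (M i))) = vec.dim (UNIV :: ('f ^ 'r) set)"
    by (intro vec.dim_image_eq) (auto intro: inj_on_subset)
  then show "vec.dim (range ((*v) (M i))) = CARD('r)" by (simp add: card_cart_basis)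
next
  show "equi_isoclinic (*s) std_ip TYPE('r) n (\<lambda>i. range ((*v) (M i)))"
    unfolding equi_isoclinic_def
  proof (intro exI[of _ "\<lambda>i. (*v) (M i)"] conjI ballI exI[of _ \<sigma>] impI allI)
    fix i j x assume ij: "i \<in> {1..n}" "j \<in> {1..n}" "i \<noteq> j"
    have "(conj_transpose (M i) ** M j ** (conj_transpose (M j) ** M i)) *v x = of_real (\<sigma>\<^sup>2) *s x"
      by (simp add: isoclinic[OF ij] scaleR_matrix_vector_mult)
    then show "(ip_adjoint std_ip std_ip ((*v) (M i)) \<circ> (*v) (M j) \<circ>
        ip_adjoint std_ip std_ip ((*v) (M j)) \<circ> (*v) (M i)) x = of_real (\<sigma>\<^sup>2) *s x"
      by (simp add: ip_adjoint_matrix matrix_vector_mul_assoc matrix_mul_assoc)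
  qed (use gram isometry_of_matrix \<open>\<sigma> \<ge> 0\<close> in auto)
  show "tight_fusion_frame (*s) std_ip n (\<lambda>i. range ((*v) (M i)))"
    unfolding tight_fusion_frame_def
  proof (intro exI[of _ a] conjI allI)
    fix v
    have "(\<Sum>i=1..n. orth_proj std_ip (range ((*v) (M i))) v) =
        (\<Sum>i=1..n. M i ** conj_transpose (M i)) *v v"
      unfolding sum_matrix_vector_mult
      by (intro sum.cong refl)
        (simp add: fd_hilbert_space.orth_proj_isometry[OF fd_hilbert_space_std isometry_of_matrix]
          gram ip_adjoint_matrix matrix_vector_mul_assoc)
    then show "(\<Sum>i=1..n. orth_proj std_ip (range ((*v) (M i))) v) = of_real a *s v"
      unfolding tight scaleR_matrix_vector_mult by simp
  qed fact
qed

section \<open>The relation (\<ast>) and the converse direction\<close>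

text \<open>For the sum \<open>S\<close>, twice \<open>conj_transpose S ** S\<close> is a double sum
  of symmetrized products, and every row of it vanishes by (\<ast>). Definiteness then gives
  \<open>S = 0\<close>.\<close>

lemma sum_eq_0_of_anticommuting:
  fixes B :: "nat \<Rightarrow> 'f::real_or_complex ^ 'r ^ 'r"
  assumes "n \<ge> 3"
    and unitary: "\<And>i. i \<in> {1..n-1} \<Longrightarrow> unitary_matrix (B i)"
    and anti: "\<And>i j. i \<in> {1..n-1} \<Longrightarrow> j \<in> {1..n-1} \<Longrightarrow> i \<noteq> j \<Longrightarrow>
      conj_transpose (B i) ** B j + conj_transpose (B j) ** B i = (- (2 / (real n - 2))) *\<^sub>R mat 1"
  shows "(\<Sum>i=1..n-1. B i) = 0"
proof -
  define S where "S = (\<Sum>i=1..n-1. B i)"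
  let ?g = "\<lambda>i j. conj_transpose (B i) ** B j"
  have SS: "conj_transpose S ** S = (\<Sum>i=1..n-1. \<Sum>j=1..n-1. ?g i j)"
    by (simp add: S_def conj_transpose_sum matrix_mult_sum_left matrix_mult_sum_right)
      (rule sum.swap)
  \<comment> \<open>Adding the same double sum with its indices exchanged turns each off-diagonal
    summand into a left-hand side of (\<ast>).\<close>
  also have "\<dots> = (\<Sum>i=1..n-1. \<Sum>j=1..n-1. ?g j i)" by (rule sum.swap)
  finally have "conj_transpose S ** S + conj_transpose S ** S =
      (\<Sum>i=1..n-1. \<Sum>j=1..n-1. ?g i j + ?g j i)"
    unfolding sum.distrib using SS by simp
  also have "\<dots> = 0"
  proof (rule sum.neutral, rule ballI)
    fix i assume i: "i \<in> {1..n-1}"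
    \<comment> \<open>In row \<open>i\<close> the diagonal contributes \<open>2 I\<close>, and the
      other \<open>n - 2\<close> entries contribute \<open>-2 / (n - 2)\<close> times
      \<open>I\<close> each.\<close>
    have "(\<Sum>j=1..n-1. ?g i j + ?g j i) =
        (?g i i + ?g i i) + (\<Sum>j\<in>{1..n-1}-{i}. ?g i j + ?g j i)"
      using i by (subst sum.remove[of _ i]) auto
    also have "(\<Sum>j\<in>{1..n-1}-{i}. ?g i j + ?g j i) =
        (\<Sum>j\<in>{1..n-1}-{i}. (- (2 / (real n - 2))) *\<^sub>R mat 1)"
      using anti i by (intro sum.cong refl) auto
    also have "\<dots> = (-2) *\<^sub>R mat 1"
    proof -
      have "card ({1..n-1} - {i}) = n - 2" using i by simp
      then have "real (card ({1..n-1} - {i})) * (- (2 / (real n - 2))) = -2"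
        using \<open>n \<ge> 3\<close> by (simp add: of_nat_diff field_simps)
      then show "(\<Sum>j\<in>{1..n-1}-{i}. (- (2 / (real n - 2))) *\<^sub>R mat 1) =
          (-2) *\<^sub>R (mat 1 :: 'f ^ 'r ^ 'r)"
        by (simp only: sum_constant_scaleR scaleR_scaleR)
    qed
    also have "?g i i = mat 1" using unitary[OF i] by (simp add: unitary_matrix_def)
    finally show "(\<Sum>j=1..n-1. ?g i j + ?g j i) = 0" by (simp add: scaleR_2)
  qed
  finally have "2 *\<^sub>R (conj_transpose S ** S) = 0" by (simp only: scaleR_2)
  then have "conj_transpose S ** S = 0" by simp
  then show ?thesis unfolding S_def by (rule conj_transpose_mult_self_eq_0)
qed

locale block_constants =
  fixes n :: nat and \<alpha> \<beta> :: real
  assumes n: "n \<ge> 3"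
    and \<alpha>_def: "\<alpha> = sqrt ((real n - 2) / (2 * real n - 2))"
    and \<beta>_def: "\<beta> = sqrt (real n / (2 * real n - 2))"
begin

lemma \<alpha>_pos: "\<alpha> > 0" and \<beta>_pos: "\<beta> > 0"
  using n by (auto simp: \<alpha>_def \<beta>_def)

lemma \<alpha>_sq: "\<alpha>\<^sup>2 = (real n - 2) / (2 * real n - 2)" and \<beta>_sq: "\<beta>\<^sup>2 = real n / (2 * real n - 2)"
  using n by (auto simp: \<alpha>_def \<beta>_def)

lemma \<alpha>\<beta>_sq: "\<alpha>\<^sup>2 + \<beta>\<^sup>2 = 1"
  using n by (simp add: \<alpha>_sq \<beta>_sq flip: add_divide_distrib)

lemma isoclinic_iff:
  fixes B B' :: "'f::real_or_complex ^ 'r ^ 'r"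
  assumes "unitary_matrix B" "unitary_matrix B'"
  defines "N \<equiv> block_column (\<alpha> *\<^sub>R mat 1) (\<beta> *\<^sub>R B)"
    and "N' \<equiv> block_column (\<alpha> *\<^sub>R mat 1) (\<beta> *\<^sub>R B')"
  shows "conj_transpose N ** N' ** (conj_transpose N' ** N) = \<alpha>\<^sup>2 *\<^sub>R mat 1 \<longleftrightarrow>
    conj_transpose B ** B' + conj_transpose B' ** B = (- (2 / (real n - 2))) *\<^sub>R mat 1"
    (is "_ \<longleftrightarrow> ?X = _")
proof -
  define c where "c = \<alpha>\<^sup>2 * \<beta>\<^sup>2"
  have c: "c \<noteq> 0" using \<alpha>_pos \<beta>_pos by (simp add: c_def)
  \<comment> \<open>The target constant is reached in two moves:
    \<open>\<alpha>\<^sup>2 + \<beta>\<^sup>2 = 1\<close> extracts the factor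
    \<open>\<beta>\<^sup>2\<close>, and the explicit values turn
    \<open>\<alpha>\<^sup>2 - \<beta>\<^sup>2 = -1 / (n - 1)\<close> into
    \<open>\<alpha>\<^sup>2\<close> times \<open>-2 / (n - 2)\<close>.\<close>
  have "\<alpha>\<^sup>2 - (\<alpha> ^ 4 + \<beta> ^ 4) = \<beta>\<^sup>2 * (\<alpha>\<^sup>2 - \<beta>\<^sup>2)"
  proof -
    have \<alpha>: "\<alpha>\<^sup>2 = 1 - \<beta>\<^sup>2" using \<alpha>\<beta>_sq by simp
    have "\<alpha> ^ 4 = (\<alpha>\<^sup>2)\<^sup>2" "\<beta> ^ 4 = (\<beta>\<^sup>2)\<^sup>2" by simp_all
    then show ?thesis unfolding \<alpha> by (simp add: power2_eq_square algebra_simps)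
  qed
  also have "\<alpha>\<^sup>2 - \<beta>\<^sup>2 = \<alpha>\<^sup>2 * (- (2 / (real n - 2)))"
  proof -
    have "x / d * (- (2 / x)) = - 2 / d" if "x \<noteq> 0" for x d :: real
      using that by simp
    from this[of "real n - 2" "2 * real n - 2"]
    have "\<alpha>\<^sup>2 * (- (2 / (real n - 2))) = - 2 / (2 * real n - 2)"
      unfolding \<alpha>_sq using n by auto
    then show ?thesis by (simp add: \<alpha>_sq \<beta>_sq flip: diff_divide_distrib)
  qed
  finally have eq: "\<alpha>\<^sup>2 - (\<alpha> ^ 4 + \<beta> ^ 4) = c * (- (2 / (real n - 2)))"
    by (simp add: c_def)
  have "conj_transpose N ** N' ** (conj_transpose N' ** N) = \<alpha>\<^sup>2 *\<^sub>R mat 1 \<longleftrightarrow>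
      c *\<^sub>R ?X = \<alpha>\<^sup>2 *\<^sub>R mat 1 - (\<alpha> ^ 4 + \<beta> ^ 4) *\<^sub>R mat 1"
    unfolding N_def N'_def gram_block_column[OF assms(1,2)] c_def
    by (auto simp: algebra_simps)
  also have "\<dots> \<longleftrightarrow> c *\<^sub>R ?X = c *\<^sub>R ((- (2 / (real n - 2))) *\<^sub>R mat 1)"
    by (simp only: scaleR_diff_left[symmetric] eq scaleR_scaleR)
  also have "\<dots> \<longleftrightarrow> ?X = (- (2 / (real n - 2))) *\<^sub>R mat 1"
    using c by (simp only: scaleR_cancel_left) simp
  finally show ?thesis .
qed

text \<open>Isoclinism comes from \<open>isoclinic_iff\<close> for two indices below
  \<open>n\<close>, and from the top blocks when one index is \<open>n\<close>. Tightness needs the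
  diagonal blocks to agree, by the choice of \<alpha> and \<beta>, and the off-diagonal ones to
  vanish, by \<open>sum_eq_0_of_anticommuting\<close>.\<close>

lemma EITFF_block_columns:
  fixes B :: "nat \<Rightarrow> 'f::real_or_complex ^ 'r ^ 'r" and \<Phi> :: "nat \<Rightarrow> 'f ^ 'r ^ ('r + 'r)"
  assumes unitary: "\<And>i. i \<in> {1..n-1} \<Longrightarrow> unitary_matrix (B i)"
    and anti: "\<And>i j. i \<in> {1..n-1} \<Longrightarrow> j \<in> {1..n-1} \<Longrightarrow> i \<noteq> j \<Longrightarrow>
      conj_transpose (B i) ** B j + conj_transpose (B j) ** B i = (- (2 / (real n - 2))) *\<^sub>R mat 1"
    and \<Phi>: "\<And>i. i \<in> {1..n-1} \<Longrightarrow> \<Phi> i = block_column (\<alpha> *\<^sub>R mat 1) (\<beta> *\<^sub>R B i)"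
    and \<Phi>n: "\<Phi> n = block_column (mat 1) 0"
  shows "EITFF (*s) std_ip (2 * CARD('r)) TYPE('r) n (\<lambda>i. range ((*v) (\<Phi> i)))"
    and "\<And>i. i \<in> {1..n} \<Longrightarrow> isometry_of (*s) std_ip (range ((*v) (\<Phi> i))) ((*v) (\<Phi> i))"
proof -
  have split: "{1..n} = insert n {1..n-1}" using n by auto
  have gram: "conj_transpose (\<Phi> i) ** \<Phi> i = mat 1" if "i \<in> {1..n}" for i
  proof (cases "i = n")
    case True
    then show ?thesis by (simp add: \<Phi>n conj_transpose_block_column_mult matrix_simps)
  next
    case False
    with that have i: "i \<in> {1..n-1}" by auto
    have "conj_transpose (\<Phi> i) ** \<Phi> i = (\<alpha>\<^sup>2 + \<beta>\<^sup>2) *\<^sub>R mat 1"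
      using unitary[OF i] by (simp add: \<Phi>[OF i] conj_transpose_block_column_mult matrix_simps
          unitary_matrix_def scaleR_add_left power2_eq_square)
    then show ?thesis by (simp add: \<alpha>\<beta>_sq)
  qed
  then show "\<And>i. i \<in> {1..n} \<Longrightarrow> isometry_of (*s) std_ip (range ((*v) (\<Phi> i))) ((*v) (\<Phi> i))"
    by (rule isometry_of_matrix)
  have with_n: "conj_transpose (\<Phi> i) ** \<Phi> n = \<alpha> *\<^sub>R mat 1"
    "conj_transpose (\<Phi> n) ** \<Phi> i = \<alpha> *\<^sub>R mat 1" if "i \<in> {1..n-1}" for i
    by (simp_all add: \<Phi>[OF that] \<Phi>n conj_transpose_block_column_mult matrix_simps)
  have isoclinic: "conj_transpose (\<Phi> i) ** \<Phi> j ** (conj_transpose (\<Phi> j) ** \<Phi> i) = \<alpha>\<^sup>2 *\<^sub>R mat 1"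
    if ij: "i \<in> {1..n}" "j \<in> {1..n}" "i \<noteq> j" for i j
  proof -
    consider "i \<in> {1..n-1}" "j \<in> {1..n-1}" | "i = n" "j \<in> {1..n-1}" | "j = n" "i \<in> {1..n-1}"
      using ij unfolding split by blast
    then show ?thesis
    proof cases
      case 1
      show ?thesis
        using isoclinic_iff[OF unitary unitary, OF 1] anti[OF 1 \<open>i \<noteq> j\<close>] by (simp only: \<Phi> 1)
    qed (simp_all add: with_n matrix_simps power2_eq_square)
  qed
  have BB: "(\<Sum>i=1..n-1. B i) = 0" using n unitary anti by (rule sum_eq_0_of_anticommuting)
  \<comment> \<open>Traces predict the frame constant \<open>n / 2\<close>: \<open>n\<close>
    projections of rank \<open>r\<close> add up to a multiple of the identity in dimension
    \<open>2 r\<close>. The sum is evaluated by its action on block columns.\<close>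
  define P where "P = (\<Sum>i=1..n-1. \<Phi> i ** conj_transpose (\<Phi> i)) + \<Phi> n ** conj_transpose (\<Phi> n)"
  have P_mult: "P ** block_column X Y = (real n / 2) *\<^sub>R block_column X Y" for X Y :: "'f ^ 'r ^ 'r"
  proof -
    have "\<Phi> i ** (conj_transpose (\<Phi> i) ** block_column X Y) =
        block_column (\<alpha>\<^sup>2 *\<^sub>R X + (\<alpha> * \<beta>) *\<^sub>R (conj_transpose (B i) ** Y))
          ((\<alpha> * \<beta>) *\<^sub>R (B i ** X) + \<beta>\<^sup>2 *\<^sub>R Y)" if i: "i \<in> {1..n-1}" for i
    proof -
      have "B i ** (conj_transpose (B i) ** Y) = Y"
        using unitary[OF i] by (simp add: matrix_mul_assoc unitary_matrix_def)
      then show ?thesis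
        by (simp add: \<Phi>[OF i] conj_transpose_block_column_mult matrix_simps block_column_mult
            scaleR_add_right power2_eq_square mult.commute block_column_scaleR block_column_add)
    qed
    then have "(\<Sum>i=1..n-1. \<Phi> i ** conj_transpose (\<Phi> i)) ** block_column X Y =
        (\<Sum>i=1..n-1. block_column (\<alpha>\<^sup>2 *\<^sub>R X + (\<alpha> * \<beta>) *\<^sub>R (conj_transpose (B i) ** Y))
          ((\<alpha> * \<beta>) *\<^sub>R (B i ** X) + \<beta>\<^sup>2 *\<^sub>R Y))"
      unfolding matrix_mult_sum_left by (intro sum.cong refl) (simp add: matrix_mul_assoc[symmetric])
    also have "\<dots> = block_column
        ((real (n - 1) * \<alpha>\<^sup>2) *\<^sub>R X + (\<alpha> * \<beta>) *\<^sub>R (conj_transpose (\<Sum>i=1..n-1. B i) ** Y))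
        ((\<alpha> * \<beta>) *\<^sub>R ((\<Sum>i=1..n-1. B i) ** X) + (real (n - 1) * \<beta>\<^sup>2) *\<^sub>R Y)"
      by (simp del: sum_constant add: block_column_sum sum.distrib sum_constant_scaleR conj_transpose_sum
          matrix_mult_sum_left scaleR_sum_right)
    \<comment> \<open>The mixed terms involve only the sum of the \<open>B i\<close> and its
      adjoint.\<close>
    also have "\<dots> = block_column ((real (n - 1) * \<alpha>\<^sup>2) *\<^sub>R X) ((real (n - 1) * \<beta>\<^sup>2) *\<^sub>R Y)"
      unfolding BB by (simp add: conj_transpose_zero)
    \<comment> \<open>The top block falls short of \<open>n / 2\<close> by exactly the 1 that
      \<open>\<Phi> n\<close> supplies.\<close>
    also have "real (n - 1) * \<alpha>\<^sup>2 = real n / 2 - 1"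
      using n by (simp add: \<alpha>_sq of_nat_diff field_simps)
    also have "real (n - 1) * \<beta>\<^sup>2 = real n / 2"
      using n by (simp add: \<beta>_sq of_nat_diff field_simps)
    finally have 1: "(\<Sum>i=1..n-1. \<Phi> i ** conj_transpose (\<Phi> i)) ** block_column X Y =
        block_column ((real n / 2 - 1) *\<^sub>R X) ((real n / 2) *\<^sub>R Y)" .
    have 2: "\<Phi> n ** conj_transpose (\<Phi> n) ** block_column X Y = block_column X 0"
      by (simp add: \<Phi>n conj_transpose_block_column_mult matrix_simps block_column_mult
          matrix_mul_assoc[symmetric])
    show ?thesis
      unfolding P_def matrix_mult_add_left 1 2 block_column_add block_column_scaleR
      by (simp add: scaleR_diff_left)
  qed
  have "P = (real n / 2) *\<^sub>R mat 1"
    by (rule block_column_mult_cancel) (simp_all add: P_mult scaleR_matrix_mult_left)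
  then have tight: "(\<Sum>i=1..n. \<Phi> i ** conj_transpose (\<Phi> i)) = (real n / 2) *\<^sub>R mat 1"
    unfolding split P_def using n by (simp add: add.commute)
  have "EITFF (*s) std_ip CARD('r + 'r) TYPE('r) n (\<lambda>i. range ((*v) (\<Phi> i)))"
    using EITFF_matrix[OF gram isoclinic _ tight] \<alpha>_pos n by simp
  then show "EITFF (*s) std_ip (2 * CARD('r)) TYPE('r) n (\<lambda>i. range ((*v) (\<Phi> i)))"
    by (simp add: mult_2)
qed

end

section \<open>The normal form, starting from adapted coordinates\<close>

text \<open>Multiplying on the right by the unitaries \<open>W i\<close> only changes the choice of
  isometries, so the subspaces stay the same. The bound \<open>s < 1\<close> makes the bottom blocks
  invertible.\<close>

lemma (in block_constants) block_normal_form: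
  fixes M :: "nat \<Rightarrow> 'f::real_or_complex ^ 'r ^ ('r + 'r)"
  assumes gram: "\<And>i. i \<in> {1..n} \<Longrightarrow> conj_transpose (M i) ** M i = mat 1"
    and isoclinic: "\<And>i j. i \<in> {1..n} \<Longrightarrow> j \<in> {1..n} \<Longrightarrow> i \<noteq> j \<Longrightarrow>
      conj_transpose (M i) ** M j ** (conj_transpose (M j) ** M i) = s *\<^sub>R mat 1"
    and tight: "(\<Sum>i=1..n. M i ** conj_transpose (M i)) = a *\<^sub>R mat 1"
    and Mn: "M n = block_column (mat 1) 0"
    and "s < 1"
  obtains W B :: "nat \<Rightarrow> 'f ^ 'r ^ 'r"
  where "\<And>i. i \<in> {1..n-1} \<Longrightarrow> unitary_matrix (W i)"
    and "\<And>i. i \<in> {1..n-1} \<Longrightarrow> M i ** W i = block_column (\<alpha> *\<^sub>R mat 1) (\<beta> *\<^sub>R B i)"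
    and "\<And>i. i \<in> {1..n-1} \<Longrightarrow> unitary_matrix (B i)"
    and "\<And>i j. i \<in> {1..n-1} \<Longrightarrow> j \<in> {1..n-1} \<Longrightarrow> i \<noteq> j \<Longrightarrow>
      conj_transpose (B i) ** B j + conj_transpose (B j) ** B i = (- (2 / (real n - 2))) *\<^sub>R mat 1"
proof -
  have split: "{1..n} = insert n {1..n-1}" using n by auto
  obtain A C where M: "\<And>i. M i = block_column (A i) (C i)"
    by (rule that[of "\<lambda>i. \<chi> k. M i $ Inl k" "\<lambda>i. \<chi> k. M i $ Inr k"])
      (rule block_column_eqI, simp_all)
  have An: "A n = mat 1" and Cn: "C n = 0"
    using Mn unfolding M by (auto simp: vec_eq_iff block_column_def split: sum.splits)
  \<comment> \<open>Since \<open>conj_transpose (M n) ** M i = A i\<close>, the pairs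
    \<open>(i, n)\<close> and \<open>(n, i)\<close> give one product each, at a point where
    \<open>s\<close> is not yet known to be nonzero.\<close>
  have AA: "conj_transpose (A i) ** A i = s *\<^sub>R mat 1" "A i ** conj_transpose (A i) = s *\<^sub>R mat 1"
    if "i \<in> {1..n-1}" for i
    using isoclinic[of i n] isoclinic[of n i] that n
    by (auto simp: M An Cn conj_transpose_block_column_mult matrix_simps)
  have CC: "conj_transpose (C i) ** C i = (1 - s) *\<^sub>R mat 1" if "i \<in> {1..n-1}" for i
    using gram[of i] AA(1)[OF that] that
    by (auto simp: M conj_transpose_block_column_mult algebra_simps)
  have CC': "C i ** conj_transpose (C i) = (1 - s) *\<^sub>R mat 1" if "i \<in> {1..n-1}" for i
    using scaled_unitary_right[OF CC[OF that]] \<open>s < 1\<close> by simp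
  \<comment> \<open>The two diagonal blocks of the tightness identity determine \<open>s\<close>.\<close>
  have corner: "(\<Sum>i=1..n. (conj_transpose E ** M i) ** conj_transpose (conj_transpose E ** M i)) =
      a *\<^sub>R (conj_transpose E ** E)" for E :: "'f ^ 'r ^ ('r + 'r)"
  proof -
    have "conj_transpose E ** (\<Sum>i=1..n. M i ** conj_transpose (M i)) ** E =
        a *\<^sub>R (conj_transpose E ** E)"
      unfolding tight by (simp add: matrix_simps)
    then show ?thesis
      by (simp add: matrix_mult_sum_left matrix_mult_sum_right matrix_simps matrix_mul_assoc)
  qed
  \<comment> \<open>This \<open>E\<close> selects the top blocks; the summand 1 is due to
    \<open>A n = mat 1\<close>. For the bottom blocks \<open>C n = 0\<close> contributes
    nothing.\<close>
  have "(real (n - 1) * s + 1) *\<^sub>R (mat 1 :: 'f ^ 'r ^ 'r) = a *\<^sub>R mat 1"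
    using corner[of "block_column (mat 1) 0"] n unfolding split M
    by (simp del: sum_constant add: conj_transpose_block_column_mult matrix_simps AA An
        sum_constant_scaleR algebra_simps)
  then have a1: "real (n - 1) * s + 1 = a" by (simp only: scaleR_mat_cancel)
  have "(real (n - 1) * (1 - s)) *\<^sub>R (mat 1 :: 'f ^ 'r ^ 'r) = a *\<^sub>R mat 1"
    using corner[of "block_column 0 (mat 1)"] n unfolding split M
    by (simp del: sum_constant add: conj_transpose_block_column_mult matrix_simps CC' Cn
        sum_constant_scaleR)
  then have a2: "real (n - 1) * (1 - s) = a" by (simp only: scaleR_mat_cancel)
  have s: "s = \<alpha>\<^sup>2" using a1 a2 n by (simp add: \<alpha>_sq of_nat_diff field_simps)
  then have s': "1 - s = \<beta>\<^sup>2" using \<alpha>\<beta>_sq by simp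
  \<comment> \<open>\<open>W i\<close> is chosen so that \<open>A i ** W i\<close> becomes \<alpha>
    times the identity, which works because \<open>s = \<alpha>\<^sup>2\<close>. \<open>B i\<close>
    is then the bottom block \<open>C i ** W i\<close> divided by \<beta>.\<close>
  define W where "W i = (1 / \<alpha>) *\<^sub>R conj_transpose (A i)" for i
  define B where "B i = (1 / (\<alpha> * \<beta>)) *\<^sub>R (C i ** conj_transpose (A i))" for i
  have W: "unitary_matrix (W i)" if "i \<in> {1..n-1}" for i
    using \<alpha>_pos
    by (simp add: unitary_matrix_def W_def matrix_simps AA[OF that] s power2_eq_square)
  have MW: "M i ** W i = block_column (\<alpha> *\<^sub>R mat 1) (\<beta> *\<^sub>R B i)" if "i \<in> {1..n-1}" for i
    using \<alpha>_pos \<beta>_pos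
    by (simp add: M W_def B_def block_column_mult block_column_scaleR matrix_simps AA[OF that] s power2_eq_square)
  have B: "unitary_matrix (B i)" if "i \<in> {1..n-1}" for i
  proof -
    have "conj_transpose (B i) ** B i =
        (1 / (\<alpha> * \<beta>))\<^sup>2 *\<^sub>R (A i ** (conj_transpose (C i) ** C i) ** conj_transpose (A i))"
      by (simp add: B_def matrix_simps matrix_mul_assoc power2_eq_square)
    also have "\<dots> = mat 1"
      using \<alpha>_pos \<beta>_pos
      by (simp add: CC[OF that] matrix_simps AA[OF that] s') (simp add: s power2_eq_square)
    finally show ?thesis
      by (simp add: unitary_matrix_def matrix_left_right_inverse)
  qed
  have BB: "conj_transpose (B i) ** B j + conj_transpose (B j) ** B i = (- (2 / (real n - 2))) *\<^sub>R mat 1"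
    if ij: "i \<in> {1..n-1}" "j \<in> {1..n-1}" "i \<noteq> j" for i j
  proof -
    \<comment> \<open>Isoclinism survives the change of isometries: \<open>W j\<close> cancels
      against its adjoint in the middle, and conjugation by \<open>W i\<close> fixes multiples of
      the identity.\<close>
    have "conj_transpose (M i ** W i) ** (M j ** W j) ** (conj_transpose (M j ** W j) ** (M i ** W i)) =
        conj_transpose (W i) ** (conj_transpose (M i) ** M j ** (W j ** conj_transpose (W j)) **
          (conj_transpose (M j) ** M i)) ** W i"
      by (simp only: conj_transpose_mult matrix_mul_assoc)
    also have "\<dots> = \<alpha>\<^sup>2 *\<^sub>R mat 1"
      using W[OF ij(1)] W[OF ij(2)] isoclinic[of i j] ij unfolding unitary_matrix_def split
      by (simp add: matrix_simps s del: atLeastAtMost_iff)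
    finally show ?thesis
      unfolding MW[OF ij(1)] MW[OF ij(2)] isoclinic_iff[OF B[OF ij(1)] B[OF ij(2)]] .
  qed
  show thesis by (rule that[of W B]) (fact W MW B BB)+
qed

section \<open>Coordinates for an abstract EITFF\<close>

text \<open>\<open>ip_adjoint\<close> is a choice term, so linearity is derived from its defining
  identity by testing against all vectors.\<close>

lemma (in fd_hilbert_space) linear_ip_adjoint:
  fixes \<Phi> :: "'f ^ 'r \<Rightarrow> 'e"
  assumes lin: "Vector_Spaces.linear (*s) smul \<Phi>"
  shows "Vector_Spaces.linear smul (*s) (ip_adjoint std_ip ip \<Phi>)"
proof -
  note adj = ip_adjoint_coordinates[OF lin, symmetric]
  interpret std: fd_hilbert_space "(*s)" "std_ip :: 'f ^ 'r \<Rightarrow> _" by (rule fd_hilbert_space_std)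
  let ?S = "ip_adjoint std_ip ip \<Phi>"
  show ?thesis
  proof unfold_locales
    show "?S (x + y) = ?S x + ?S y" for x y
      by (rule std.ip_left_cancel) (simp only: adj std.ip_add ip_add)
    show "?S (smul c x) = c *s ?S x" for c x
      by (rule std.ip_left_cancel) (simp only: adj std.ip_smul ip_smul)
  qed
qed

text \<open>The finite spanning set contains a basis, which places the abstract space in the
  finite-dimensional setting where injectivity and equal dimensions give surjectivity.\<close>

lemma (in fd_hilbert_space) surj_if_inj_coordinates:
  fixes f :: "'f ^ 'd \<Rightarrow> 'e"
  assumes "Vector_Spaces.linear (*s) smul f" "inj f" "dim UNIV = CARD('d)"
  shows "surj f"
proof -
  obtain S where S: "finite S" "span S = UNIV" using finite_spanning by blast
  obtain Bs where Bs: "Bs \<subseteq> S" "independent Bs" "S \<subseteq> span Bs"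
    by (rule basis_exists[of S])
  have "span Bs = UNIV"
    using span_minimal[OF Bs(3) subspace_span] S(2) by auto
  with Bs S interpret fd: finite_dimensional_vector_space smul Bs
    by unfold_locales (auto intro: finite_subset)
  interpret pair: finite_dimensional_vector_space_pair "(*s)" cart_basis smul Bs ..
  show ?thesis
    by (rule pair.linear_injective_imp_surjective) (use assms in \<open>simp_all add: card_cart_basis\<close>)
qed

lemma (in fd_hilbert_space) ip_diff: "ip x (y - z) = ip x y - ip x z"
  using ip_add[of x "y - z" z] by simp

lemma (in fd_hilbert_space) ip_add_left: "ip (x + y) z = ip x z + ip y z"
  by (simp only: ip_conjugate[of x z] ip_conjugate[of y z] ip_conjugate[of "x + y" z] ip_add conjugate_dist_add)

lemma (in fd_hilbert_space) ip_diff_left: "ip (x - y) z = ip x z - ip y z"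
  using ip_add_left[of "x - y" y z] by simp

lemma (in fd_hilbert_space) ip_smul_left: "ip (smul c x) z = conjugate c * ip x z"
  by (simp only: ip_conjugate[of x z] ip_conjugate[of "smul c x" z] ip_smul conjugate_dist_mul)

lemma (in fd_hilbert_space) ip_nonneg: "\<exists>a\<ge>0. ip x x = of_real a"
proof (cases "x = 0")
  case True
  then show ?thesis using ip_smul[of 0 0 0] by auto
qed (use ip_pos in fastforce)

text \<open>The coordinates are adapted to the splitting of the space into \<open>U n\<close> and
  its orthogonal complement: \<open>\<psi> n\<close> parametrizes the first summand, and a rescaled
  projection of \<open>\<psi> 1\<close> the second.\<close>

lemma (in fd_hilbert_space) EITFF_coordinates:
  fixes U :: "nat \<Rightarrow> 'e set"
  assumes EITFF: "EITFF smul ip (2 * CARD('r)) TYPE('r::finite) n U" and "n \<ge> 2"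
  obtains T and M :: "nat \<Rightarrow> 'f ^ 'r ^ ('r + 'r)" and s a :: real
  where "unitary_map smul ip (*s) std_ip T"
    and "\<And>i. i \<in> {1..n} \<Longrightarrow> T ` U i = range ((*v) (M i))"
    and "\<And>i. i \<in> {1..n} \<Longrightarrow> conj_transpose (M i) ** M i = mat 1"
    and "\<And>i j. i \<in> {1..n} \<Longrightarrow> j \<in> {1..n} \<Longrightarrow> i \<noteq> j \<Longrightarrow>
      conj_transpose (M i) ** M j ** (conj_transpose (M j) ** M i) = s *\<^sub>R mat 1"
    and "(\<Sum>i=1..n. M i ** conj_transpose (M i)) = a *\<^sub>R mat 1"
    and "M n = block_column (mat 1) 0"
    and "s < 1"
proof -
  interpret r: fd_hilbert_space "(*s)" "std_ip :: 'f ^ 'r \<Rightarrow> _" by (rule fd_hilbert_space_std)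
  interpret rr: fd_hilbert_space "(*s)" "std_ip :: 'f ^ ('r + 'r) \<Rightarrow> _" by (rule fd_hilbert_space_std)
  from EITFF have dimE: "dim UNIV = 2 * CARD('r)"
    and subU: "\<And>i. i \<in> {1..n} \<Longrightarrow> subspace (U i)"
    and dimU: "\<And>i. i \<in> {1..n} \<Longrightarrow> dim (U i) = CARD('r)"
    and iso: "equi_isoclinic smul ip TYPE('r) n U" and tight: "tight_fusion_frame smul ip n U"
    unfolding EITFF_def by auto
  from iso obtain \<psi> :: "nat \<Rightarrow> 'f ^ 'r \<Rightarrow> 'e" and \<sigma> where
    \<psi>: "\<And>i. i \<in> {1..n} \<Longrightarrow> isometry_of smul ip (U i) (\<psi> i)" and
    iso: "\<And>i j x. i \<in> {1..n} \<Longrightarrow> j \<in> {1..n} \<Longrightarrow> i \<noteq> j \<Longrightarrow>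
      (ip_adjoint std_ip ip (\<psi> i) \<circ> \<psi> j \<circ> ip_adjoint std_ip ip (\<psi> j) \<circ> \<psi> i) x = of_real (\<sigma>\<^sup>2) *s x"
    unfolding equi_isoclinic_def by blast
  define s where "s = \<sigma>\<^sup>2"
  define \<psi>' where "\<psi>' i = ip_adjoint std_ip ip (\<psi> i)" for i
  have lin: "Vector_Spaces.linear (*s) smul (\<psi> i)" and U: "U i = range (\<psi> i)"
    and inv: "\<psi>' i (\<psi> i x) = x" if "i \<in> {1..n}" for i x
    using \<psi>[OF that] unfolding isometry_of_def \<psi>'_def by (auto simp: fun_eq_iff)
  have adj: "ip (\<psi> i x) y = std_ip x (\<psi>' i y)" if "i \<in> {1..n}" for i x y
    unfolding \<psi>'_def by (rule ip_adjoint_coordinates[OF lin[OF that]])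
  have lin': "Vector_Spaces.linear smul (*s) (\<psi>' i)" if "i \<in> {1..n}" for i
    unfolding \<psi>'_def by (rule linear_ip_adjoint[OF lin[OF that]])
  have iso: "\<psi>' i (\<psi> j (\<psi>' j (\<psi> i x))) = of_real s *s x"
    if "i \<in> {1..n}" "j \<in> {1..n}" "i \<noteq> j" for i j x
    using iso[OF that] by (simp add: \<psi>'_def s_def)
  from tight obtain a where "a > 0"
    and "\<And>v. (\<Sum>i=1..n. orth_proj ip (U i) v) = smul (of_real a) v"
    unfolding tight_fusion_frame_def by blast
  then have tight: "(\<Sum>i=1..n. \<psi> i (\<psi>' i v)) = smul (of_real a) v" for v
    using orth_proj_isometry[OF \<psi>] by (simp add: \<psi>'_def)

  have n1: "n \<in> {1..n}" "1 \<in> {1..n}" "1 \<noteq> n" using \<open>n \<ge> 2\<close> by auto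
  interpret p: Vector_Spaces.linear "(*s)" smul "\<psi> n" by (rule lin[OF n1(1)])
  interpret p': Vector_Spaces.linear smul "(*s)" "\<psi>' n" by (rule lin'[OF n1(1)])
  interpret q: Vector_Spaces.linear "(*s)" smul "\<psi> 1" by (rule lin[OF n1(2)])

  \<comment> \<open>The component of \<open>\<psi> i x\<close> orthogonal to \<open>U n\<close>.
    Isoclinism makes \<open>C i\<close> an isometry up to the squared scale
    \<open>1 - s\<close>.\<close>
  define C where "C i x = \<psi> i x - \<psi> n (\<psi>' n (\<psi> i x))" for i x
  have pC: "ip (\<psi> n x) (C i y) = 0" for i x y
    by (simp add: C_def ip_diff adj[OF n1(1)] inv[OF n1(1)])
  then have Cp: "ip (C i y) (\<psi> n x) = 0" for i x y
    using ip_conjugate[of "C i y" "\<psi> n x"] by simp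
  have CC: "ip (C i x) (C i y) = of_real (1 - s) * std_ip x y" if "i \<in> {1..n}" "i \<noteq> n" for i x y
  proof -
    have "ip (C i x) (C i y) = ip (\<psi> i x) (C i y)"
      by (subst C_def) (simp add: ip_diff_left pC)
    also have "\<dots> = std_ip x y - std_ip x (\<psi>' i (\<psi> n (\<psi>' n (\<psi> i y))))"
      by (simp add: C_def ip_diff adj[OF that(1)] inv[OF that(1)])
    also have "\<dots> = of_real (1 - s) * std_ip x y"
      by (simp add: iso[OF that(1) n1(1) that(2)] r.ip_smul algebra_simps)
    finally show ?thesis .
  qed
  \<comment> \<open>Otherwise all \<open>U i\<close> coincide, and tightness forces \<open>U n\<close> to be the whole space.\<close>
  have "s < 1"
  proof (rule ccontr)
    assume "\<not> s < 1"
    \<comment> \<open>The squared norm of \<open>C i x\<close> is \<open>1 - s\<close> times that of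
      \<open>x\<close>, hence at most 0 here.\<close>
    have C0: "C i x = 0" if "i \<in> {1..n}" "i \<noteq> n" for i x
    proof (rule ccontr)
      assume "C i x \<noteq> 0"
      then obtain b where b: "b > 0" "ip (C i x) (C i x) = of_real b" using ip_pos by blast
      obtain c where c: "c \<ge> 0" "std_ip x x = of_real c" using r.ip_nonneg by blast
      have "of_real b = (of_real ((1 - s) * c) :: 'f)"
        using CC[OF that, of x x] b(2) c(2) by simp
      then have "b = (1 - s) * c" by (simp only: of_real_eq_iff)
      moreover have "(1 - s) * c \<le> 0"
        using c(1) \<open>\<not> s < 1\<close> by (intro mult_nonpos_nonneg) auto
      ultimately show False using b(1) by simp
    qed
    have "\<psi> i x \<in> U n" if "i \<in> {1..n}" for i x
      using C0[OF that, of x] U[OF n1(1)] by (cases "i = n") (auto simp: C_def)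
    then have "smul (of_real a) v \<in> U n" for v
      unfolding tight[symmetric] by (intro subspace_sum subU n1)
    then have "smul (of_real (1 / a)) (smul (of_real a) v) \<in> U n" for v
      by (rule subspace_scale[OF subU[OF n1(1)]])
    moreover have "smul (of_real (1 / a)) (smul (of_real a) v) = v" for v
      using \<open>a > 0\<close> by simp
    ultimately have "v \<in> U n" for v by metis
    then have "U n = UNIV" by auto
    with dimU[OF n1(1)] dimE show False by simp
  qed

  \<comment> \<open>The factor that turns \<open>C 1\<close> into an isometry. Index 1 serves as an
    index different from \<open>n\<close>.\<close>
  define t where "t = 1 / sqrt (1 - s)"
  have t: "t * t * (1 - s) = 1" using \<open>s < 1\<close> by (simp add: t_def)
  define D where "D = C 1"
  have pD: "ip (\<psi> n x) (D y) = 0" and Dp: "ip (D y) (\<psi> n x) = 0"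
    and DD: "ip (D x) (D y) = of_real (1 - s) * std_ip x y" for x y
    unfolding D_def by (fact pC Cp CC[OF n1(2,3)])+
  \<comment> \<open>The inverse of the desired unitary. Its two summands have orthogonal ranges and
    are isometric in the two halves of \<open>z\<close>, so \<open>S\<close> preserves inner
    products.\<close>
  define S where "S z = \<psi> n (\<chi> k. z $ Inl k) + smul (of_real t) (D (\<chi> k. z $ Inr k))"
    for z :: "'f ^ ('r + 'r)"
  have vec_simps: "(\<chi> k. (x + y) $ f k) = (\<chi> k. x $ f k) + (\<chi> k. y $ f k)"
    "(\<chi> k. (c *s x) $ f k) = c *s (\<chi> k. x $ f k)"
    for x y :: "'f ^ ('r + 'r)" and c and f :: "'r \<Rightarrow> 'r + 'r"
    by (simp_all add: vec_eq_iff)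
  have S_lin: "Vector_Spaces.linear (*s) smul S"
  proof unfold_locales
    show "S (x + y) = S x + S y" for x y
      unfolding S_def D_def vec_simps C_def p.add p'.add q.add
      by (simp add: algebra_simps scale_right_distrib scale_right_diff_distrib)
    show "S (c *s x) = smul c (S x)" for c x
      unfolding S_def D_def vec_simps C_def p.scale p'.scale q.scale
      by (simp add: algebra_simps scale_right_distrib scale_right_diff_distrib)
  qed
  have S_ip: "ip (S z) (S w) = std_ip z w" for z w
  proof -
    let ?l = "\<lambda>z. \<chi> k. z $ Inl k" and ?r = "\<lambda>z. \<chi> k. z $ Inr k"
    have "ip (S z) (S w) = std_ip (?l z) (?l w) + of_real (t * t * (1 - s)) * std_ip (?r z) (?r w)"
      unfolding S_def ip_add ip_add_left ip_smul ip_smul_left pD Dp DD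
      by (simp add: adj[OF n1(1)] inv[OF n1(1)] mult.assoc)
    also have "\<dots> = std_ip z w"
      unfolding t by (simp add: std_ip_def sum_UNIV_Plus)
    finally show ?thesis .
  qed
  \<comment> \<open>The adjoint of an isometry is a left inverse; the dimension \<open>2 r\<close>
    of the space makes \<open>S\<close> surjective, so \<open>T\<close> is a two-sided
    inverse.\<close>
  define T where "T = ip_adjoint std_ip ip S"
  have TS: "T (S z) = z" for z
    by (rule rr.ip_left_cancel) (simp add: T_def S_ip flip: ip_adjoint_coordinates[OF S_lin])
  have "surj S"
    by (rule surj_if_inj_coordinates[OF S_lin]) (use TS dimE in \<open>auto simp: mult_2 intro: inj_on_inverseI[of _ T]\<close>)
  then have ST: "S (T v) = v" for v using TS by (metis surjD)
  have T_lin: "Vector_Spaces.linear smul (*s) T"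
    unfolding T_def by (rule linear_ip_adjoint[OF S_lin])
  interpret T: Vector_Spaces.linear smul "(*s)" T by (rule T_lin)

  define M where "M i = matrix (T \<circ> \<psi> i)" for i
  have M: "M i *v x = T (\<psi> i x)" if "i \<in> {1..n}" for i x
    using matrix_works[OF Vector_Spaces.linear_compose[OF lin[OF that] T_lin]] by (simp add: M_def)
  \<comment> \<open>\<open>S\<close> is the adjoint of the unitary \<open>T\<close>, so the adjoint
    of \<open>T \<circ> \<psi> i\<close> is \<open>\<psi>' i \<circ> S\<close>. All matrix
    identities below follow by cancelling \<open>S\<close> against \<open>T\<close>.\<close>
  have M': "conj_transpose (M i) *v y = \<psi>' i (S y)" if "i \<in> {1..n}" for i y
    by (rule r.ip_left_cancel)
      (metis M[OF that] adj[OF that] std_ip_matrix S_ip ST)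
  show thesis
  proof (rule that[of T M s a])
    show "unitary_map smul ip (*s) std_ip T"
      unfolding unitary_map_def
      using T_lin TS ST S_ip by (metis bijI injI surjI)
    show "T ` U i = range ((*v) (M i))" if "i \<in> {1..n}" for i
      by (auto simp: U[OF that] M[OF that])
    show "conj_transpose (M i) ** M i = mat 1" if "i \<in> {1..n}" for i
      by (simp add: matrix_eq M[OF that] M'[OF that] ST inv[OF that] flip: matrix_vector_mul_assoc)
    show "conj_transpose (M i) ** M j ** (conj_transpose (M j) ** M i) = s *\<^sub>R mat 1"
      if "i \<in> {1..n}" "j \<in> {1..n}" "i \<noteq> j" for i j
      by (simp add: matrix_eq M[OF that(1)] M[OF that(2)] M'[OF that(1)] M'[OF that(2)] ST iso[OF that]
          scaleR_matrix_vector_mult flip: matrix_vector_mul_assoc)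
    show "(\<Sum>i=1..n. M i ** conj_transpose (M i)) = a *\<^sub>R mat 1"
      unfolding matrix_eq
    proof
      fix y
      have "(\<Sum>i=1..n. M i ** conj_transpose (M i)) *v y = (\<Sum>i=1..n. T (\<psi> i (\<psi>' i (S y))))"
        unfolding sum_matrix_vector_mult
        by (intro sum.cong refl) (simp only: M M' flip: matrix_vector_mul_assoc)
      also have "\<dots> = (a *\<^sub>R mat 1) *v y"
        unfolding scaleR_matrix_vector_mult T.sum[symmetric] tight T.scale TS by simp
      finally show "(\<Sum>i=1..n. M i ** conj_transpose (M i)) *v y = (a *\<^sub>R mat 1) *v y" .
    qed
    show "M n = block_column (mat 1) 0"
      unfolding matrix_eq M[OF n1(1)]
    proof
      fix x :: "'f ^ 'r"
      let ?v = "block_column (mat 1) 0 *v x :: 'f ^ ('r + 'r)"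
      have v: "(\<chi> k. ?v $ Inl k) = x" "(\<chi> k. ?v $ Inr k) = 0"
        by (simp_all add: vec_eq_iff block_column_def matrix_vector_mult_def mat_def if_distrib
            if_distribR cong: if_cong)
      \<comment> \<open>The right half of \<open>?v\<close> is zero, so only the
        \<open>\<psi> n\<close> summand of \<open>S\<close> remains.\<close>
      have "S ?v = \<psi> n x"
        unfolding S_def D_def C_def v q.zero p'.zero p.zero by simp
      then show "T (\<psi> n x) = block_column (mat 1) 0 *v x"
        using TS by metis
    qed
  qed fact
qed

section \<open>Both directions combined\<close>

theorem theorem3p1:
  fixes n :: nat and \<alpha> \<beta> :: real
  assumes "n \<ge> 3"
    and "\<alpha> = sqrt ((real n - 2) / (2 * real n - 2))"
    and "\<beta> = sqrt (real n / (2 * real n - 2))"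
  shows
    "(\<forall>(smul :: 'f::real_or_complex \<Rightarrow> 'e::ab_group_add \<Rightarrow> 'e) (ip :: 'e \<Rightarrow> 'e \<Rightarrow> 'f) U.
        EITFF smul ip (2 * CARD('r)) TYPE('r::finite) n U \<longrightarrow>
        (\<exists>(V :: nat \<Rightarrow> ('f ^ ('r + 'r)) set) (\<Phi> :: nat \<Rightarrow> 'f ^ 'r ^ ('r + 'r)) (B :: nat \<Rightarrow> 'f ^ 'r ^ 'r).
           equivalent_seq smul ip (*s) std_ip n U V \<and>
           EITFF (*s) std_ip (2 * CARD('r)) TYPE('r) n V \<and>
           (\<forall>i\<in>{1..n}. isometry_of (*s) std_ip (V i) ((*v) (\<Phi> i))) \<and>
           (\<forall>i\<in>{1..n-1}. \<Phi> i = block_column (\<alpha> *\<^sub>R mat 1) (\<beta> *\<^sub>R B i)) \<and>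
           \<Phi> n = block_column (mat 1) 0 \<and>
           (\<forall>i\<in>{1..n-1}. unitary_matrix (B i)) \<and>
           (\<forall>i\<in>{1..n-1}. \<forall>j\<in>{1..n-1}. i \<noteq> j \<longrightarrow>
              conj_transpose (B i) ** B j + conj_transpose (B j) ** B i
                = (- (2 / (real n - 2))) *\<^sub>R mat 1)))
     \<and>
     (\<forall>(B :: nat \<Rightarrow> 'f ^ 'r ^ 'r) (\<Phi> :: nat \<Rightarrow> 'f ^ 'r ^ ('r + 'r)).
        (\<forall>i\<in>{1..n-1}. unitary_matrix (B i)) \<and>
        (\<forall>i\<in>{1..n-1}. \<forall>j\<in>{1..n-1}. i \<noteq> j \<longrightarrow>
           conj_transpose (B i) ** B j + conj_transpose (B j) ** B i
             = (- (2 / (real n - 2))) *\<^sub>R mat 1) \<and>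
        (\<forall>i\<in>{1..n-1}. \<Phi> i = block_column (\<alpha> *\<^sub>R mat 1) (\<beta> *\<^sub>R B i)) \<and>
        \<Phi> n = block_column (mat 1) 0 \<longrightarrow>
        (\<exists>V :: nat \<Rightarrow> ('f ^ ('r + 'r)) set.
           EITFF (*s) std_ip (2 * CARD('r)) TYPE('r) n V \<and>
           (\<forall>i\<in>{1..n}. isometry_of (*s) std_ip (V i) ((*v) (\<Phi> i)))))"
proof -
  interpret block_constants n \<alpha> \<beta> by unfold_locales fact+
  have forward: "\<exists>(V :: nat \<Rightarrow> ('f ^ ('r + 'r)) set) (\<Phi> :: nat \<Rightarrow> 'f ^ 'r ^ ('r + 'r)) (B :: nat \<Rightarrow> 'f ^ 'r ^ 'r).
           equivalent_seq smul ip (*s) std_ip n U V \<and>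
           EITFF (*s) std_ip (2 * CARD('r)) TYPE('r) n V \<and>
           (\<forall>i\<in>{1..n}. isometry_of (*s) std_ip (V i) ((*v) (\<Phi> i))) \<and>
           (\<forall>i\<in>{1..n-1}. \<Phi> i = block_column (\<alpha> *\<^sub>R mat 1) (\<beta> *\<^sub>R B i)) \<and>
           \<Phi> n = block_column (mat 1) 0 \<and>
           (\<forall>i\<in>{1..n-1}. unitary_matrix (B i)) \<and>
           (\<forall>i\<in>{1..n-1}. \<forall>j\<in>{1..n-1}. i \<noteq> j \<longrightarrow>
              conj_transpose (B i) ** B j + conj_transpose (B j) ** B i
                = (- (2 / (real n - 2))) *\<^sub>R mat 1)"
    if EITFF: "EITFF smul ip (2 * CARD('r)) TYPE('r) n U"
    for smul :: "'f \<Rightarrow> 'e \<Rightarrow> 'e" and ip U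
  proof -
    interpret fd_hilbert_space smul ip using EITFF by (simp add: EITFF_def)
    have "n \<ge> 2" using n by simp
    from EITFF_coordinates[OF EITFF this]
    obtain T and M :: "nat \<Rightarrow> 'f ^ 'r ^ ('r + 'r)" and s a :: real where
      T: "unitary_map smul ip (*s) std_ip T"
      and TU: "\<And>i. i \<in> {1..n} \<Longrightarrow> T ` U i = range ((*v) (M i))"
      and M: "\<And>i. i \<in> {1..n} \<Longrightarrow> conj_transpose (M i) ** M i = mat 1"
        "\<And>i j. i \<in> {1..n} \<Longrightarrow> j \<in> {1..n} \<Longrightarrow> i \<noteq> j \<Longrightarrow>
          conj_transpose (M i) ** M j ** (conj_transpose (M j) ** M i) = s *\<^sub>R mat 1"
        "(\<Sum>i=1..n. M i ** conj_transpose (M i)) = a *\<^sub>R mat 1"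
        "M n = block_column (mat 1) 0" "s < 1"
      by blast
    from block_normal_form[OF M] obtain W B :: "nat \<Rightarrow> 'f ^ 'r ^ 'r" where
      W: "\<And>i. i \<in> {1..n-1} \<Longrightarrow> unitary_matrix (W i)"
      and MW: "\<And>i. i \<in> {1..n-1} \<Longrightarrow> M i ** W i = block_column (\<alpha> *\<^sub>R mat 1) (\<beta> *\<^sub>R B i)"
      and B: "\<And>i. i \<in> {1..n-1} \<Longrightarrow> unitary_matrix (B i)"
        "\<And>i j. i \<in> {1..n-1} \<Longrightarrow> j \<in> {1..n-1} \<Longrightarrow> i \<noteq> j \<Longrightarrow>
          conj_transpose (B i) ** B j + conj_transpose (B j) ** B i = (- (2 / (real n - 2))) *\<^sub>R mat 1"
      by blast
    \<comment> \<open>The last isometry already has the required form, so it gets no right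
      factor.\<close>
    define \<Phi> where "\<Phi> i = (if i = n then M n else M i ** W i)" for i
    have \<Phi>: "\<Phi> i = block_column (\<alpha> *\<^sub>R mat 1) (\<beta> *\<^sub>R B i)" if "i \<in> {1..n-1}" for i
      using MW[OF that] that by (auto simp: \<Phi>_def)
    have \<Phi>n: "\<Phi> n = block_column (mat 1) 0"
      by (simp add: \<Phi>_def M(4))
    have "range ((*v) (\<Phi> i)) = T ` U i" if i: "i \<in> {1..n}" for i
    proof (cases "i = n")
      case False
      with i have "i \<in> {1..n-1}" by auto
      then have "surj ((*v) (W i))"
        using W matrix_right_invertible_surjective unfolding unitary_matrix_def by blast
      then have "range ((*v) (M i ** W i)) = range ((*v) (M i))"
        by (metis (no_types, lifting) fun_eq_iff comp_apply image_comp matrix_vector_mul_assoc)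
      then show ?thesis by (simp add: \<Phi>_def False TU[OF i])
    qed (use TU[OF i] in \<open>simp add: \<Phi>_def\<close>)
    then have "equivalent_seq smul ip (*s) std_ip n U (\<lambda>i. range ((*v) (\<Phi> i)))"
      unfolding equivalent_seq_def using T by blast
    with EITFF_block_columns[of B \<Phi>, OF B \<Phi> \<Phi>n] \<Phi> \<Phi>n B show ?thesis
      by (intro exI[of _ "\<lambda>i. range ((*v) (\<Phi> i))"] exI[of _ \<Phi>] exI[of _ B] conjI ballI impI) simp_all
  qed
  show ?thesis
  proof (intro conjI allI impI, goal_cases)
    case (1 smul ip U)
    then show ?case by (rule forward)
  next
    case (2 B \<Phi>)
    then have B: "\<And>i. i \<in> {1..n-1} \<Longrightarrow> unitary_matrix (B i)"
      "\<And>i j. i \<in> {1..n-1} \<Longrightarrow> j \<in> {1..n-1} \<Longrightarrow> i \<noteq> j \<Longrightarrow>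
        conj_transpose (B i) ** B j + conj_transpose (B j) ** B i = (- (2 / (real n - 2))) *\<^sub>R mat 1"
      "\<And>i. i \<in> {1..n-1} \<Longrightarrow> \<Phi> i = block_column (\<alpha> *\<^sub>R mat 1) (\<beta> *\<^sub>R B i)"
      "\<Phi> n = block_column (mat 1) 0"
      by simp_all
    show ?case
      by (intro exI[of _ "\<lambda>i. range ((*v) (\<Phi> i))"] conjI ballI EITFF_block_columns[of B \<Phi>, OF B])
  qed
qed

end
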